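(* Let $\mathbf U^e=(\rho^e,0,0,\mathcal E^e)^T$ be a general known hydrostatic state solution of the two-dimensional Euler equations with gravity, i.e. zero velocity and $\nabla p^e=-\rho^e\nabla\phi$. Consider the semi-discrete nodal DG scheme, for all cells $(i,j)$ and $0\le i_1,j_1\le k$, $$\begin{aligned}\frac{\mathrm d\mathbf U_{i_1,j_1}^{i,j}}{\mathrm dt}=&-\frac{2}{\Delta x}\sum_{l=0}^k2D_{i_1,l}\mathbf F^S(\mathbf U_{i_1,j_1}^{i,j},\mathbf U_{l,j_1}^{i,j})+\frac2{\Delta x}\frac{\tau_{i_1}}{\omega_{i_1}}\left(\mathbf F(\mathbf U_{i_1,j_1}^{i,j})-\mathbf F_{i_1,j_1}^{*,i,j}\right)\\&-\frac{2}{\Delta y}\sum_{l=0}^k2D_{j_1,l}\mathbf G^S(\mathbf U_{i_1,j_1}^{i,j},\mathbf U_{i_1,l}^{i,j})+\frac2{\Delta y}\frac{\tau_{j_1}}{\omega_{j_1}}\left(\mathbf G(\mathbf U_{i_1,j_1}^{i,j})-\mathbf G_{i_1,j_1}^{*,i,j}\right)+\mathbf S_{i_1,j_1}^{i,j},\end{aligned}$$ where (omitting the indices $i,j,i_1,j_1$) $\mathbf S=\left(0,\frac2{\Delta x}\rho\Theta,\frac2{\Delta y}\rho\Xi,\frac2{\Delta x}m\Theta+\frac2{\Delta y}n\Xi\right)^T$ with $$\Theta_{i_1,j_1}^{i,j}=\frac1{\rho_{i_1,j_1}^{e,i,j}}\sum_{l=0}^k2D_{i_1,l}F_2^S(\mathbf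 U_{i_1,j_1}^{e,i,j},\mathbf U_{l,j_1}^{e,i,j}),\qquad \Xi_{i_1,j_1}^{i,j}=\frac1{\rho_{i_1,j_1}^{e,i,j}}\sum_{l=0}^k2D_{j_1,l}G_3^S(\mathbf U_{i_1,l}^{e,i,j},\mathbf U_{i_1,j_1}^{e,i,j}),$$ $\mathbf F^S,\mathbf G^S$ are entropy conservative fluxes, the interface fluxes are built from entropy stable fluxes $\hat{\mathbf F},\hat{\mathbf G}$, and all notation is as in the context. Write the scheme as $\frac{\mathrm d\mathbf U_h}{\mathrm dt}=\mathcal L_h(\mathbf U_h)$. Then the scheme is well-balanced for $\mathbf U^e$: $$\mathcal L_h(\mathbf U_h)=\mathbf 0\qquad\text{if }\mathbf U_h=\mathbf U_h^e,$$ where $\mathbf U_h^e$ is the interpolant of $\mathbf U^e$ at the tensor-product Gauss–Lobatto points of each cell.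
   Context: Equations: $\mathbf U_t+\mathbf F(\mathbf U)_x+\mathbf G(\mathbf U)_y=\mathbf S(\mathbf U,x,y)$ with $\mathbf U=(\rho,m,n,\mathcal E)^T$, $m=\rho u$, $n=\rho v$, $\mathbf F=(m,\rho u^2+p,\rho uv,u(\mathcal E+p))^T$, $\mathbf G=(n,\rho uv,\rho v^2+p,v(\mathcal E+p))^T$, $\mathbf S=(0,-\rho\phi_x,-\rho\phi_y,-m\phi_x-n\phi_y)^T$, $\phi=\phi(x,y)$ a given time-independent potential, $\mathcal E=\frac p{\gamma-1}+\frac12\rho(u^2+v^2)$, $\gamma=1.4$. States are required to lie in the admissible set $\mathscr G=\{\mathbf U:\rho>0,\ p>0\}$. Mesh: $[a,b]\times[c,d]$ is divided into $N_x\times N_y$ uniform rectangular cells $K_{ij}$ of size $\Delta x\times\Delta y$ with centers $(x_i,y_j)$. Let $-1=X_0<\dots<X_k=1$ be the $k+1$ Gauss–Lobatto points on $[-1,1]$ with weights $\omega_l$, $Y_l=X_l$, $L_l$ the Lagrange basis with $L_l(X_j)=\delta_{lj}$, $D_{jl}=L_l'(X_j)$, and $\tau_0=-1$, $\tau_k=1$, $\tau_l=0$ for $0<l<k$. $\mathbf U_{i_1,j_1}^{i,j}$ is the nodal value of the numerical solution in $K_{ij}$ at $(x_i+\frac{\Delta x}2X_{i_1},\,y_j+\frac{\Delta y}2Y_{j_1})$; $\mathbf U_{i_1,j_1}^{e,i,j}$, $\rho_{i_1,j_1}^{e,i,j}$ are the values of $\mathbf U^e$, $\rho^e$ at that point.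 Interface fluxes: $\mathbf F^{*,i,j}_{0,j_1}=\hat{\mathbf F}(\mathbf U^{i-1,j}_{k,j_1},\mathbf U^{i,j}_{0,j_1})$, $\mathbf F^{*,i,j}_{k,j_1}=\hat{\mathbf F}(\mathbf U^{i,j}_{k,j_1},\mathbf U^{i+1,j}_{0,j_1})$, zero for $0<i_1<k$; $\mathbf G^{*,i,j}_{i_1,0}=\hat{\mathbf G}(\mathbf U^{i,j-1}_{i_1,k},\mathbf U^{i,j}_{i_1,0})$, $\mathbf G^{*,i,j}_{i_1,k}=\hat{\mathbf G}(\mathbf U^{i,j}_{i_1,k},\mathbf U^{i,j+1}_{i_1,0})$, zero for $0<j_1<k$. No particular boundary condition is specified at the domain boundary. Entropy notation: $s=\ln(p\rho^{-\gamma})$, $\mathcal U=-\frac{\rho s}{\gamma-1}$, $\mathbf V=\mathcal U'(\mathbf U)^T=\left(\frac{\gamma-s}{\gamma-1}-\frac{\rho(u^2+v^2)}{2p},\frac{\rho u}p,\frac{\rho v}p,-\frac\rho p\right)^T$, $\psi_F=\rho u$, $\psi_G=\rho v$. Entropy conservative fluxes $\mathbf F^S,\mathbf G^S$ (with components $F^S_r$, $G^S_r$): consistent ($\mathbf F^S(\mathbf U,\mathbf U)=\mathbf F(\mathbf U)$, $\mathbf G^S(\mathbf U,\mathbf U)=\mathbf G(\mathbf U)$), symmetric in their two arguments, with $(\mathbf V_R-\mathbf V_L)^T\mathbf F^S(\mathbf U_L,\mathbf U_R)=\psi_{F,R}-\psi_{F,L}$ and $(\mathbf V_R-\mathbf V_L)^T\mathbf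 G^S(\mathbf U_L,\mathbf U_R)=\psi_{G,R}-\psi_{G,L}$. Entropy stable fluxes $\hat{\mathbf F},\hat{\mathbf G}$: consistent with $\mathbf F$, $\mathbf G$, and with $(\mathbf V_R-\mathbf V_L)^T\hat{\mathbf F}(\mathbf U_L,\mathbf U_R)\le\psi_{F,R}-\psi_{F,L}$ and $(\mathbf V_R-\mathbf V_L)^T\hat{\mathbf G}(\mathbf U_L,\mathbf U_R)\le\psi_{G,R}-\psi_{G,L}$.
   Formalization: Added: between admissible states at rest, F^S and G^S have only a pressure component (entropy conservation, symmetry and consistency do not imply this, and the claim fails without it); exterior traces at the domain boundary are assumed equal to U^e there. *)

theory Defs
  imports "HOL-Analysis.Analysis" "HOL-Computational_Algebra.Polynomial"
begin

section \<open>Euler equations and entropy structure\<close>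

text \<open>A state is \<open>U = (\<rho>, m, n, \<E>)\<close> with \<open>m = \<rho>u\<close>, \<open>n = \<rho>v\<close>.\<close>

type_synonym state = "real ^ 4"

definition adiab :: real where "adiab = 14 / 10"

definition vel_x :: "state \<Rightarrow> real" where "vel_x U = U $ 2 / U $ 1"

definition vel_y :: "state \<Rightarrow> real" where "vel_y U = U $ 3 / U $ 1"

text \<open>\<open>\<E> = p / (\<gamma> - 1) + \<rho>(u\<^sup>2 + v\<^sup>2) / 2\<close>, solved for \<open>p\<close>.\<close>

definition pressure :: "state \<Rightarrow> real" where
  "pressure U = (adiab - 1) * (U $ 4 - U $ 1 * ((vel_x U)\<^sup>2 + (vel_y U)\<^sup>2) / 2)"

definition admissible :: "state set" where
  "admissible = {U. U $ 1 > 0 \<and> pressure U > 0}"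

lemma vector_4 [simp]:
  "(vector [a,b,c,d] :: real^4) $ 1 = a" "(vector [a,b,c,d] :: real^4) $ 2 = b"
  "(vector [a,b,c,d] :: real^4) $ 3 = c" "(vector [a,b,c,d] :: real^4) $ 4 = d"
  unfolding vector_def by simp_all

definition flux_F :: "state \<Rightarrow> state" where
  "flux_F U = vector
     [U $ 2,
      U $ 1 * (vel_x U)\<^sup>2 + pressure U,
      U $ 1 * vel_x U * vel_y U,
      vel_x U * (U $ 4 + pressure U)]"

definition flux_G :: "state \<Rightarrow> state" where
  "flux_G U = vector
     [U $ 3,
      U $ 1 * vel_x U * vel_y U,
      U $ 1 * (vel_y U)\<^sup>2 + pressure U,
      vel_y U * (U $ 4 + pressure U)]"

definition spec_entropy :: "state \<Rightarrow> real" where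
  "spec_entropy U = ln (pressure U * (U $ 1) powr (- adiab))"

definition entropy :: "state \<Rightarrow> real" where
  "entropy U = - (U $ 1 * spec_entropy U / (adiab - 1))"

definition entropy_vars :: "state \<Rightarrow> state" where
  "entropy_vars U = vector
     [(adiab - spec_entropy U) / (adiab - 1)
        - U $ 1 * ((vel_x U)\<^sup>2 + (vel_y U)\<^sup>2) / (2 * pressure U),
      U $ 1 * vel_x U / pressure U,
      U $ 1 * vel_y U / pressure U,
      - (U $ 1 / pressure U)]"

lemma kinetic_eq: assumes "U $ 1 > 0" shows "U $ 1 * ((vel_x U)\<^sup>2 + (vel_y U)\<^sup>2) = ((U$2)^2 + (U$3)^2) / U$1"
  using assms by (simp add: vel_x_def vel_y_def power2_eq_square field_simps)

lemma entropy_gradient: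
  assumes "U \<in> admissible"
  shows "GDERIV entropy U :> entropy_vars U"
proof -
  have r: "U $ 1 > 0" and p: "pressure U > 0" using assms by (auto simp: admissible_def)
  define P where "P = (\<lambda>W::state. (adiab - 1) * (W $ 4 - ((W $ 2)\<^sup>2 + (W $ 3)\<^sup>2) / (2 * W $ 1)))"
  have PP: "pressure W = P W" if "W $ 1 > 0" for W
    using kinetic_eq[OF that] that by (simp add: pressure_def P_def)
  define E where "E = (\<lambda>W::state. - (W $ 1 * (ln (P W) - adiab * ln (W $ 1)) / (adiab - 1)))"
  have op: "open {W::state. W $ 1 > 0 \<and> P W > 0}"
  proof -
    have o1: "open {W::state. W $ 1 > 0}" by (intro open_Collect_less continuous_intros)
    have "open ({W::state. W $ 1 > 0} \<inter> P -` {0<..})"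
      by (rule continuous_open_preimage[OF _ o1]) (auto simp: P_def intro!: continuous_intros)
    also have "({W::state. W $ 1 > 0} \<inter> P -` {0<..}) = {W::state. W $ 1 > 0 \<and> P W > 0}" by auto
    finally show ?thesis .
  qed
  have EE: "entropy W = E W" if "W \<in> {W::state. W $ 1 > 0 \<and> P W > 0}" for W
    using that by (simp add: entropy_def spec_entropy_def E_def PP ln_mult ln_powr)
  have nth: "((\<lambda>W::state. W $ i) has_derivative (\<lambda>h. h $ i)) (at U)" for i
    by (rule bounded_linear_imp_has_derivative[OF bounded_linear_vec_nth])
  have Pp: "P U > 0" using p PP r by simp
  have s: "spec_entropy U = ln (P U) - adiab * ln (U$1)" using r Pp by (simp add: spec_entropy_def PP ln_mult ln_powr)
  have dP: "(P has_derivative (\<lambda>h. (adiab - 1) * (h $ 4 - ((2 * (U $ 2) * h $ 2 + 2 * (U $ 3) * h $ 3) / (2 * U $ 1) - ((U $ 2)\<^sup>2 + (U $ 3)\<^sup>2) * h $ 1 / (2 * (U $ 1)^2))))) (at U)"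
    unfolding P_def
    by (rule has_derivative_eq_rhs, (rule derivative_intros nth)+) (use r in \<open>auto simp: fun_eq_iff field_simps power2_eq_square\<close>)
  have "(E has_derivative (\<lambda>h. h \<bullet> entropy_vars U)) (at U)"
    unfolding E_def
    apply (rule has_derivative_eq_rhs)
    apply ((rule derivative_intros nth dP | (simp add: adiab_def r Pp; fail)))+
    apply (rule ext)
    apply (simp add: inner_vec_def sum_4 entropy_vars_def vector_4 PP r s vel_x_def vel_y_def)
    using r Pp apply (simp add: adiab_def field_simps power2_eq_square)
    done
  then have "(entropy has_derivative (\<lambda>h. h \<bullet> entropy_vars U)) (at U)"
    by (rule has_derivative_transform_within_open[OF _ op]) (use r Pp EE in auto)
  then show ?thesis by (simp add: gderiv_def)
qed

definition psi_F :: "state \<Rightarrow> real" where "psi_F U = U $ 1 * vel_x U"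

definition psi_G :: "state \<Rightarrow> real" where "psi_G U = U $ 1 * vel_y U"

section \<open>Two-point numerical fluxes\<close>

definition consistent_flux ::
  "(state \<Rightarrow> state) \<Rightarrow> (state \<Rightarrow> state \<Rightarrow> state) \<Rightarrow> bool" where
  "consistent_flux f h \<longleftrightarrow> (\<forall>U\<in>admissible. h U U = f U)"

definition entropy_conservative_flux ::
  "(state \<Rightarrow> state) \<Rightarrow> (state \<Rightarrow> real) \<Rightarrow> (state \<Rightarrow> state \<Rightarrow> state) \<Rightarrow> bool" where
  "entropy_conservative_flux f \<psi> h \<longleftrightarrow>
     consistent_flux f h \<and>
     (\<forall>UL\<in>admissible. \<forall>UR\<in>admissible.
        h UL UR = h UR UL \<and>
        (entropy_vars UR - entropy_vars UL) \<bullet> h UL UR = \<psi> UR - \<psi> UL)"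

definition entropy_stable_flux ::
  "(state \<Rightarrow> state) \<Rightarrow> (state \<Rightarrow> real) \<Rightarrow> (state \<Rightarrow> state \<Rightarrow> state) \<Rightarrow> bool" where
  "entropy_stable_flux f \<psi> h \<longleftrightarrow>
     consistent_flux f h \<and>
     (\<forall>UL\<in>admissible. \<forall>UR\<in>admissible.
        (entropy_vars UR - entropy_vars UL) \<bullet> h UL UR \<le> \<psi> UR - \<psi> UL)"

text \<open>
  Between two fluids at rest a two-point flux carries no mass, no transversal momentum and no
  energy, as is the case for \<open>F\<close> and \<open>G\<close> themselves. Consistency, symmetry and
  the entropy identity do not imply this: adding
  \<open>(V\<^sub>1(U\<^sub>R) - V\<^sub>1(U\<^sub>L)) (V\<^sub>3(U\<^sub>L) - V\<^sub>3(U\<^sub>R), 0, V\<^sub>1(U\<^sub>R) - V\<^sub>1(U\<^sub>L), 0)\<close> to an entropy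
  conservative flux \<open>F\<^sup>S\<close> gives another one.
\<close>

definition at_rest :: "state \<Rightarrow> bool" where
  "at_rest U \<longleftrightarrow> U $ 2 = 0 \<and> U $ 3 = 0"

definition rest_compatible_F :: "(state \<Rightarrow> state \<Rightarrow> state) \<Rightarrow> bool" where
  "rest_compatible_F h \<longleftrightarrow>
     (\<forall>UL\<in>admissible. \<forall>UR\<in>admissible. at_rest UL \<and> at_rest UR \<longrightarrow>
        h UL UR $ 1 = 0 \<and> h UL UR $ 3 = 0 \<and> h UL UR $ 4 = 0)"

definition rest_compatible_G :: "(state \<Rightarrow> state \<Rightarrow> state) \<Rightarrow> bool" where
  "rest_compatible_G h \<longleftrightarrow>
     (\<forall>UL\<in>admissible. \<forall>UR\<in>admissible. at_rest UL \<and> at_rest UR \<longrightarrow>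
        h UL UR $ 1 = 0 \<and> h UL UR $ 2 = 0 \<and> h UL UR $ 4 = 0)"

section \<open>Hydrostatic states\<close>

text \<open>Gradients are taken relative to the closed domain, i.e. one-sided on its boundary.\<close>

definition hydrostatic_state ::
  "(real \<times> real) set \<Rightarrow> (real \<times> real \<Rightarrow> real) \<Rightarrow> (real \<times> real \<Rightarrow> state) \<Rightarrow> bool" where
  "hydrostatic_state D \<phi> Ue \<longleftrightarrow>
     (\<forall>z\<in>D. Ue z \<in> admissible \<and> at_rest (Ue z) \<and>
        (\<exists>grad. (\<phi> has_derivative (\<lambda>h. grad \<bullet> h)) (at z within D) \<and>
           ((\<lambda>z. pressure (Ue z)) has_derivative (\<lambda>h. (- (Ue z $ 1) *\<^sub>R grad) \<bullet> h))
             (at z within D)))"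

section \<open>Gauss--Lobatto points\<close>

text \<open>The \<open>k + 1\<close> point rule containing both endpoints with degree of exactness \<open>2k - 1\<close>.\<close>

definition gauss_lobatto :: "nat \<Rightarrow> (nat \<Rightarrow> real) \<Rightarrow> (nat \<Rightarrow> real) \<Rightarrow> bool" where
  "gauss_lobatto k X w \<longleftrightarrow>
     k \<ge> 1 \<and> X 0 = -1 \<and> X k = 1 \<and> strict_mono_on {0..k} X \<and>
     (\<forall>q::real poly. degree q \<le> 2 * k - 1 \<longrightarrow>
        (\<Sum>l=0..k. w l * poly q (X l)) = integral {-1..1} (poly q))"

definition lagrange_basis :: "nat \<Rightarrow> (nat \<Rightarrow> real) \<Rightarrow> nat \<Rightarrow> real poly" where
  "lagrange_basis k X l = (\<Prod>j\<in>{0..k} - {l}. smult (1 / (X l - X j)) [:- X j, 1:])"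

definition diff_matrix :: "nat \<Rightarrow> (nat \<Rightarrow> real) \<Rightarrow> nat \<Rightarrow> nat \<Rightarrow> real" where
  "diff_matrix k X j l = poly (pderiv (lagrange_basis k X l)) (X j)"

definition tau :: "nat \<Rightarrow> nat \<Rightarrow> real" where
  "tau k l = (if l = 0 then -1 else if l = k then 1 else 0)"

section \<open>The nodal DG scheme\<close>

record dg_mesh =
  xlo :: real
  xhi :: real
  ylo :: real
  yhi :: real
  numx :: nat
  numy :: nat
  deg :: nat
  node :: "nat \<Rightarrow> real"
  weight :: "nat \<Rightarrow> real"

definition valid_mesh :: "dg_mesh \<Rightarrow> bool" where
  "valid_mesh M \<longleftrightarrow>
     xlo M < xhi M \<and> ylo M < yhi M \<and> numx M \<ge> 1 \<and> numy M \<ge> 1 \<and>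
     gauss_lobatto (deg M) (node M) (weight M)"

definition domain_of :: "dg_mesh \<Rightarrow> (real \<times> real) set" where
  "domain_of M = {xlo M..xhi M} \<times> {ylo M..yhi M}"

definition dx :: "dg_mesh \<Rightarrow> real" where "dx M = (xhi M - xlo M) / real (numx M)"

definition dy :: "dg_mesh \<Rightarrow> real" where "dy M = (yhi M - ylo M) / real (numy M)"

definition point :: "dg_mesh \<Rightarrow> nat \<Rightarrow> nat \<Rightarrow> nat \<Rightarrow> nat \<Rightarrow> real \<times> real" where
  "point M i j i1 j1 =
     (xlo M + (real i - 1/2) * dx M + dx M / 2 * node M i1,
      ylo M + (real j - 1/2) * dy M + dy M / 2 * node M j1)"

text \<open>
  \<open>U i j i1 j1\<close> is the value at node \<open>(i1, j1)\<close> of cell \<open>(i, j)\<close>. The cells of the mesh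
  are those with \<open>i \<in> {1..numx}\<close>, \<open>j \<in> {1..numy}\<close>; the indices \<open>0\<close>, \<open>numx + 1\<close> and
  \<open>numy + 1\<close> denote ghost cells, in which the interface fluxes find their exterior traces.
\<close>

type_synonym dg_fun = "nat \<Rightarrow> nat \<Rightarrow> nat \<Rightarrow> nat \<Rightarrow> state"

definition cell :: "dg_mesh \<Rightarrow> nat \<Rightarrow> nat \<Rightarrow> bool" where
  "cell M i j \<longleftrightarrow> i \<in> {1..numx M} \<and> j \<in> {1..numy M}"

definition interpolates :: "dg_mesh \<Rightarrow> (real \<times> real \<Rightarrow> state) \<Rightarrow> dg_fun \<Rightarrow> bool" where
  "interpolates M Ue U \<longleftrightarrow>
     (\<forall>i j i1 j1. cell M i j \<and> i1 \<le> deg M \<and> j1 \<le> deg M \<longrightarrow>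
        U i j i1 j1 = Ue (point M i j i1 j1))"

text \<open>
  The boundary treatment is an arbitrary map \<open>bc\<close> from the numerical solution to ghost values
  (periodic, Dirichlet, reflecting, ...).
\<close>

definition with_ghosts :: "dg_mesh \<Rightarrow> (dg_fun \<Rightarrow> dg_fun) \<Rightarrow> dg_fun \<Rightarrow> dg_fun" where
  "with_ghosts M bc U i j = (if cell M i j then U i j else bc U i j)"

text \<open>
  At the boundary nodes the exterior traces assigned to \<open>U\<close> are the values of \<open>Ue\<close>;
  all four points below lie on the boundary of the domain.
\<close>

definition bc_matches ::
  "dg_mesh \<Rightarrow> (dg_fun \<Rightarrow> dg_fun) \<Rightarrow> (real \<times> real \<Rightarrow> state) \<Rightarrow> dg_fun \<Rightarrow> bool" where
  "bc_matches M bc Ue U \<longleftrightarrow>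
     (\<forall>j\<in>{1..numy M}. \<forall>j1\<le>deg M.
        bc U 0 j (deg M) j1 = Ue (point M 0 j (deg M) j1) \<and>
        bc U (numx M + 1) j 0 j1 = Ue (point M (numx M + 1) j 0 j1)) \<and>
     (\<forall>i\<in>{1..numx M}. \<forall>i1\<le>deg M.
        bc U i 0 i1 (deg M) = Ue (point M i 0 i1 (deg M)) \<and>
        bc U i (numy M + 1) i1 0 = Ue (point M i (numy M + 1) i1 0))"

definition interface_F ::
  "dg_mesh \<Rightarrow> (state \<Rightarrow> state \<Rightarrow> state) \<Rightarrow> dg_fun \<Rightarrow> dg_fun" where
  "interface_F M Fh U i j i1 j1 =
     (if i1 = 0 then Fh (U (i - 1) j (deg M) j1) (U i j 0 j1)
      else if i1 = deg M then Fh (U i j (deg M) j1) (U (i + 1) j 0 j1)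
      else 0)"

definition interface_G ::
  "dg_mesh \<Rightarrow> (state \<Rightarrow> state \<Rightarrow> state) \<Rightarrow> dg_fun \<Rightarrow> dg_fun" where
  "interface_G M Gh U i j i1 j1 =
     (if j1 = 0 then Gh (U i (j - 1) i1 (deg M)) (U i j i1 0)
      else if j1 = deg M then Gh (U i j i1 (deg M)) (U i (j + 1) i1 0)
      else 0)"

definition Theta ::
  "dg_mesh \<Rightarrow> (state \<Rightarrow> state \<Rightarrow> state) \<Rightarrow> (real \<times> real \<Rightarrow> state)
     \<Rightarrow> nat \<Rightarrow> nat \<Rightarrow> nat \<Rightarrow> nat \<Rightarrow> real" where
  "Theta M FS Ue i j i1 j1 =
     1 / (Ue (point M i j i1 j1) $ 1) *
     (\<Sum>l=0..deg M. 2 * diff_matrix (deg M) (node M) i1 l *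
        FS (Ue (point M i j i1 j1)) (Ue (point M i j l j1)) $ 2)"

definition Xi ::
  "dg_mesh \<Rightarrow> (state \<Rightarrow> state \<Rightarrow> state) \<Rightarrow> (real \<times> real \<Rightarrow> state)
     \<Rightarrow> nat \<Rightarrow> nat \<Rightarrow> nat \<Rightarrow> nat \<Rightarrow> real" where
  "Xi M GS Ue i j i1 j1 =
     1 / (Ue (point M i j i1 j1) $ 1) *
     (\<Sum>l=0..deg M. 2 * diff_matrix (deg M) (node M) j1 l *
        GS (Ue (point M i j i1 l)) (Ue (point M i j i1 j1)) $ 3)"

definition source ::
  "dg_mesh \<Rightarrow> (state \<Rightarrow> state \<Rightarrow> state) \<Rightarrow> (state \<Rightarrow> state \<Rightarrow> state)
     \<Rightarrow> (real \<times> real \<Rightarrow> state) \<Rightarrow> dg_fun \<Rightarrow> dg_fun" where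
  "source M FS GS Ue U i j i1 j1 =
     (let W = U i j i1 j1; T = Theta M FS Ue i j i1 j1; Z = Xi M GS Ue i j i1 j1 in
      vector
        [0,
         2 / dx M * W $ 1 * T,
         2 / dy M * W $ 1 * Z,
         2 / dx M * W $ 2 * T + 2 / dy M * W $ 3 * Z])"

text \<open>Right-hand side \<open>L\<^sub>h(U\<^sub>h)\<close> of the scheme \<open>dU\<^sub>h / dt = L\<^sub>h(U\<^sub>h)\<close>.\<close>

definition dg_rhs ::
  "dg_mesh \<Rightarrow> (dg_fun \<Rightarrow> dg_fun)
     \<Rightarrow> (state \<Rightarrow> state \<Rightarrow> state) \<Rightarrow> (state \<Rightarrow> state \<Rightarrow> state)
     \<Rightarrow> (state \<Rightarrow> state \<Rightarrow> state) \<Rightarrow> (state \<Rightarrow> state \<Rightarrow> state)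
     \<Rightarrow> (real \<times> real \<Rightarrow> state) \<Rightarrow> dg_fun \<Rightarrow> dg_fun" where
  "dg_rhs M bc FS GS Fh Gh Ue U i j i1 j1 =
     - ((2 / dx M) *\<^sub>R (\<Sum>l=0..deg M.
          (2 * diff_matrix (deg M) (node M) i1 l) *\<^sub>R FS (U i j i1 j1) (U i j l j1)))
     + (2 / dx M * (tau (deg M) i1 / weight M i1)) *\<^sub>R
         (flux_F (U i j i1 j1) - interface_F M Fh (with_ghosts M bc U) i j i1 j1)
     - (2 / dy M) *\<^sub>R (\<Sum>l=0..deg M.
          (2 * diff_matrix (deg M) (node M) j1 l) *\<^sub>R GS (U i j i1 j1) (U i j i1 l))
     + (2 / dy M * (tau (deg M) j1 / weight M j1)) *\<^sub>R
         (flux_G (U i j i1 j1) - interface_G M Gh (with_ghosts M bc U) i j i1 j1)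
     + source M FS GS Ue U i j i1 j1"

end

theory Submission
  imports Defs
begin

text \<open>
  The two nodes that meet at a cell interface are the same point of the plane, so for the
  interpolant of a function the interface fluxes have equal arguments and consistency
  cancels every surface term. The remaining volume terms involve only pairs of states at rest, so
  they contribute to the momentum components alone, where the source discretisation is built to
  cancel them: \<open>m = n = 0\<close>, the factors \<open>\<rho>\<close> and \<open>1 / \<rho>\<^sup>e\<close> compensate, and the reversed arguments
  of \<open>G\<^sup>S\<close> in \<open>\<Xi>\<close> do not matter by symmetry.
\<close>

lemma gauss_lobatto_node_bounds:
  assumes "gauss_lobatto k X w" "l \<le> k"
  shows "- 1 \<le> X l" "X l \<le> 1"
proof -
  have ends: "X 0 = - 1" "X k = 1" and mono: "mono_on {0..k} X"
    using assms(1) by (auto simp: gauss_lobatto_def intro: strict_mono_on_imp_mono_on)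
  show "- 1 \<le> X l" "X l \<le> 1"
    using mono_onD[OF mono, of 0 l] mono_onD[OF mono, of l k] assms(2) ends by auto
qed

lemma cell_coordinate_bounds:
  fixes lo hi x :: real
  assumes "lo < hi" "1 \<le> i" "i \<le> n" "- 1 \<le> x" "x \<le> 1"
  defines "h \<equiv> (hi - lo) / real n"
  shows "lo + (real i - 1/2) * h + h / 2 * x \<in> {lo..hi}"
proof -
  have h: "h > 0" "real n * h = hi - lo"
    using assms by (auto simp: h_def)
  \<comment> \<open>Measured from \<open>lo\<close> in cell widths, the coordinate is
    \<open>real i - 1/2 + x / 2\<close>, which lies between \<open>i - 1\<close> and
    \<open>i\<close>, hence between 0 and \<open>n\<close>.\<close>
  have eq: "lo + (real i - 1/2) * h + h / 2 * x = lo + (real i - 1/2 + x / 2) * h"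
    by (simp add: algebra_simps)
  have "0 \<le> (real i - 1/2 + x / 2) * h"
    using assms h(1) by (intro mult_nonneg_nonneg) auto
  moreover have "(real i - 1/2 + x / 2) * h \<le> real n * h"
    using assms h(1) by (intro mult_right_mono) auto
  ultimately show ?thesis
    unfolding eq using h(2) by auto
qed

text \<open>Admissibility and rest of \<open>Ue\<close> are given on the closed domain only; this
  carries them over to all nodal values.\<close>

lemma point_in_domain:
  assumes "valid_mesh M" "cell M i j" "i1 \<le> deg M" "j1 \<le> deg M"
  shows "point M i j i1 j1 \<in> domain_of M"
proof -
  have gl: "gauss_lobatto (deg M) (node M) (weight M)"
    using assms(1) by (simp add: valid_mesh_def)
  show ?thesis
    unfolding point_def domain_of_def dx_def dy_def
    using assms gauss_lobatto_node_bounds[OF gl]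
    by (intro SigmaI cell_coordinate_bounds) (auto simp: valid_mesh_def cell_def)
qed

text \<open>The end nodes -1 and 1 sit half a cell width from the centers. The index
  \<open>i\<close> is unrestricted, so that interfaces with ghost cells are covered too.\<close>

lemma point_interface_x:
  assumes "valid_mesh M"
  shows "point M (Suc i) j 0 j1 = point M i j (deg M) j1"
  using assms by (simp add: point_def valid_mesh_def gauss_lobatto_def algebra_simps)

lemma point_interface_y:
  assumes "valid_mesh M"
  shows "point M i (Suc j) i1 0 = point M i j i1 (deg M)"
  using assms by (simp add: point_def valid_mesh_def gauss_lobatto_def algebra_simps)

text \<open>A disjunction is needed because at interior nodes the interface flux is 0 by convention
  while \<open>flux_F\<close> contains the pressure; there the factor \<open>tau\<close> removes the
  term.\<close>

lemma surface_term_F_zero: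
  assumes mesh: "valid_mesh M" and cons: "consistent_flux flux_F Fh"
    and adm: "\<forall>z\<in>domain_of M. Ue z \<in> admissible"
    and interp: "interpolates M Ue U" and boundary: "bc_matches M bc Ue U"
    and cell: "cell M i j" and i1: "i1 \<le> deg M" and j1: "j1 \<le> deg M"
  shows "tau (deg M) i1 = 0 \<or>
         interface_F M Fh (with_ghosts M bc U) i j i1 j1 = flux_F (U i j i1 j1)"
proof -
  have U: "U i' j i2 j1 = Ue (point M i' j i2 j1)" if "cell M i' j" "i2 \<le> deg M" for i' i2
    using interp that j1 by (auto simp: interpolates_def)
  have j: "j \<in> {1..numy M}"
    using cell by (simp add: cell_def)
  have same: "Fh (U i j i1 j1) (U i j i1 j1) = flux_F (U i j i1 j1)"
    using cons adm point_in_domain[OF mesh cell i1 j1] U[OF cell i1]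
    by (simp add: consistent_flux_def)
  \<comment> \<open>Cells are numbered from 1, so \<open>i - 1\<close> is a true predecessor;
    \<open>i' = 0\<close> is the ghost column.\<close>
  obtain i' where i': "i = Suc i'"
    using cell by (cases i) (auto simp: cell_def)
  \<comment> \<open>In a ghost cell the outer trace is a value of \<open>Ue\<close> by
    \<open>bc_matches\<close>, in a mesh cell by interpolation; either way it is taken at the shared
    interface point.\<close>
  have left: "with_ghosts M bc U i' j (deg M) j1 = U i j 0 j1"
    using boundary cell j j1 U[of i' "deg M"] U[of i 0] point_interface_x[OF mesh, of i' j j1]
    by (cases "i' = 0") (auto simp: with_ghosts_def cell_def bc_matches_def i')
  have right: "with_ghosts M bc U (Suc i) j 0 j1 = U i j (deg M) j1"
  proof (cases "i = numx M")
    case True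
    then show ?thesis
      using boundary cell j j1 U[of i "deg M"] point_interface_x[OF mesh, of i j j1]
      by (auto simp: with_ghosts_def cell_def bc_matches_def)
  next
    case False
    then have "cell M (Suc i) j"
      using cell by (auto simp: cell_def)
    then show ?thesis
      using cell U[of i "deg M"] U[of "Suc i" 0] point_interface_x[OF mesh, of i j j1]
      by (simp add: with_ghosts_def)
  qed
  show ?thesis
    using left right same cell by (auto simp: tau_def interface_F_def with_ghosts_def i')
qed

lemma surface_term_G_zero:
  assumes mesh: "valid_mesh M" and cons: "consistent_flux flux_G Gh"
    and adm: "\<forall>z\<in>domain_of M. Ue z \<in> admissible"
    and interp: "interpolates M Ue U" and boundary: "bc_matches M bc Ue U"
    and cell: "cell M i j" and i1: "i1 \<le> deg M" and j1: "j1 \<le> deg M"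
  shows "tau (deg M) j1 = 0 \<or>
         interface_G M Gh (with_ghosts M bc U) i j i1 j1 = flux_G (U i j i1 j1)"
proof -
  have U: "U i j' i1 j2 = Ue (point M i j' i1 j2)" if "cell M i j'" "j2 \<le> deg M" for j' j2
    using interp that i1 by (auto simp: interpolates_def)
  have i: "i \<in> {1..numx M}"
    using cell by (simp add: cell_def)
  have same: "Gh (U i j i1 j1) (U i j i1 j1) = flux_G (U i j i1 j1)"
    using cons adm point_in_domain[OF mesh cell i1 j1] U[OF cell j1]
    by (simp add: consistent_flux_def)
  obtain j' where j': "j = Suc j'"
    using cell by (cases j) (auto simp: cell_def)
  have lower: "with_ghosts M bc U i j' i1 (deg M) = U i j i1 0"
    using boundary cell i i1 U[of j' "deg M"] U[of j 0] point_interface_y[OF mesh, of i j' i1]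
    by (cases "j' = 0") (auto simp: with_ghosts_def cell_def bc_matches_def j')
  have upper: "with_ghosts M bc U i (Suc j) i1 0 = U i j i1 (deg M)"
  proof (cases "j = numy M")
    case True
    then show ?thesis
      using boundary cell i i1 U[of j "deg M"] point_interface_y[OF mesh, of i j i1]
      by (auto simp: with_ghosts_def cell_def bc_matches_def)
  next
    case False
    then have "cell M i (Suc j)"
      using cell by (auto simp: cell_def)
    then show ?thesis
      using cell U[of j "deg M"] U[of "Suc j" 0] point_interface_y[OF mesh, of i j i1]
      by (simp add: with_ghosts_def)
  qed
  show ?thesis
    using lower upper same cell by (auto simp: tau_def interface_G_def with_ghosts_def j')
qed

text \<open>All values involved belong to one cell, and the sums agree term by term in
  \<open>l\<close>, so the balance is exact and not merely up to quadrature error.\<close>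

lemma volume_and_source_cancel:
  assumes mesh: "valid_mesh M"
    and rest: "\<forall>z\<in>domain_of M. Ue z \<in> admissible \<and> at_rest (Ue z)"
    and FS_rest: "rest_compatible_F FS" and GS_rest: "rest_compatible_G GS"
    and GS_sym: "\<forall>UL\<in>admissible. \<forall>UR\<in>admissible. GS UL UR = GS UR UL"
    and interp: "interpolates M Ue U"
    and cell: "cell M i j" and i1: "i1 \<le> deg M" and j1: "j1 \<le> deg M"
  shows "source M FS GS Ue U i j i1 j1 =
         (2 / dx M) *\<^sub>R (\<Sum>l=0..deg M.
            (2 * diff_matrix (deg M) (node M) i1 l) *\<^sub>R FS (U i j i1 j1) (U i j l j1)) +
         (2 / dy M) *\<^sub>R (\<Sum>l=0..deg M.
            (2 * diff_matrix (deg M) (node M) j1 l) *\<^sub>R GS (U i j i1 j1) (U i j i1 l))"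
proof -
  have U: "U i j a b = Ue (point M i j a b)"
    and adm: "U i j a b \<in> admissible" and at_rest: "at_rest (U i j a b)"
    if "a \<le> deg M" "b \<le> deg M" for a b
    using interp cell that rest point_in_domain[OF mesh cell that]
    by (auto simp: interpolates_def)
  have rho: "U i j i1 j1 $ 1 \<noteq> 0"
    using adm[OF i1 j1] by (auto simp: admissible_def)
  have F0: "FS (U i j i1 j1) (U i j l j1) $ 1 = 0" "FS (U i j i1 j1) (U i j l j1) $ 3 = 0"
    "FS (U i j i1 j1) (U i j l j1) $ 4 = 0" if "l \<le> deg M" for l
    using FS_rest adm at_rest that i1 j1 by (auto simp: rest_compatible_F_def)
  have G0: "GS (U i j i1 j1) (U i j i1 l) $ 1 = 0" "GS (U i j i1 j1) (U i j i1 l) $ 2 = 0"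
    "GS (U i j i1 j1) (U i j i1 l) $ 4 = 0" if "l \<le> deg M" for l
    using GS_rest adm at_rest that i1 j1 by (auto simp: rest_compatible_G_def)
  have mom: "U i j i1 j1 $ 2 = 0" "U i j i1 j1 $ 3 = 0"
    using at_rest[OF i1 j1] by (auto simp: at_rest_def)
  \<comment> \<open>Folding the values of \<open>Ue\<close> back into nodal values identifies the
    reference density with that of \<open>U\<close>, so the density quotient is 1.\<close>
  have Theta: "U i j i1 j1 $ 1 * Theta M FS Ue i j i1 j1 =
      (\<Sum>l=0..deg M. 2 * diff_matrix (deg M) (node M) i1 l * FS (U i j i1 j1) (U i j l j1) $ 2)"
    using rho i1 j1 by (simp add: Theta_def flip: U)
  have Xi: "U i j i1 j1 $ 1 * Xi M GS Ue i j i1 j1 =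
      (\<Sum>l=0..deg M. 2 * diff_matrix (deg M) (node M) j1 l * GS (U i j i1 j1) (U i j i1 l) $ 3)"
  proof -
    have "GS (U i j i1 l) (U i j i1 j1) = GS (U i j i1 j1) (U i j i1 l)" if "l \<le> deg M" for l
      using GS_sym adm that i1 j1 by blast
    then show ?thesis
      using rho i1 j1 by (simp add: Xi_def flip: U)
  qed
  \<comment> \<open>Component 2 retains only the sum over \<open>FS\<close>, component 3 only that
    over \<open>GS\<close>; components 1 and 4 vanish on both sides.\<close>
  show ?thesis
    using Theta Xi
    by (simp add: vec_eq_iff forall_4 source_def Let_def mom F0 G0 mult.assoc)
qed

theorem theorem4p1:
  fixes M :: dg_mesh
    and \<phi> :: "real \<times> real \<Rightarrow> real"
    and Ue :: "real \<times> real \<Rightarrow> state"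
    and FS GS Fh Gh :: "state \<Rightarrow> state \<Rightarrow> state"
    and bc :: "dg_fun \<Rightarrow> dg_fun"
    and Uh :: dg_fun
  assumes mesh: "valid_mesh M"
    and hydrostatic: "hydrostatic_state (domain_of M) \<phi> Ue"
    and FS: "entropy_conservative_flux flux_F psi_F FS"
    and GS: "entropy_conservative_flux flux_G psi_G GS"
    and FS_rest: "rest_compatible_F FS"
    and GS_rest: "rest_compatible_G GS"
    and Fh: "entropy_stable_flux flux_F psi_F Fh"
    and Gh: "entropy_stable_flux flux_G psi_G Gh"
    and interp: "interpolates M Ue Uh"
    and boundary: "bc_matches M bc Ue Uh"
  shows "\<forall>i j i1 j1. cell M i j \<and> i1 \<le> deg M \<and> j1 \<le> deg M \<longrightarrow>
           dg_rhs M bc FS GS Fh Gh Ue Uh i j i1 j1 = 0"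
proof (intro allI impI)
  fix i j i1 j1
  assume "cell M i j \<and> i1 \<le> deg M \<and> j1 \<le> deg M"
  then have ix: "cell M i j" "i1 \<le> deg M" "j1 \<le> deg M"
    by auto
  have rest: "\<forall>z\<in>domain_of M. Ue z \<in> admissible \<and> at_rest (Ue z)"
    using hydrostatic by (auto simp: hydrostatic_state_def)
  have GS_sym: "\<forall>UL\<in>admissible. \<forall>UR\<in>admissible. GS UL UR = GS UR UL"
    using GS by (auto simp: entropy_conservative_flux_def)
  have consistent: "consistent_flux flux_F Fh" "consistent_flux flux_G Gh"
    using Fh Gh by (auto simp: entropy_stable_flux_def)
  have surface:
    "tau (deg M) i1 = 0 \<or>
       interface_F M Fh (with_ghosts M bc Uh) i j i1 j1 = flux_F (Uh i j i1 j1)"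
    "tau (deg M) j1 = 0 \<or>
       interface_G M Gh (with_ghosts M bc Uh) i j i1 j1 = flux_G (Uh i j i1 j1)"
    using rest
    by (intro surface_term_F_zero[OF mesh consistent(1) _ interp boundary ix]
        surface_term_G_zero[OF mesh consistent(2) _ interp boundary ix]; blast)+
  \<comment> \<open>Rewriting the source yields the volume sums with opposite sign; each surface
    term has a zero coefficient or a zero flux difference.\<close>
  show "dg_rhs M bc FS GS Fh Gh Ue Uh i j i1 j1 = 0"
    using surface
    by (auto simp: dg_rhs_def
        volume_and_source_cancel[OF mesh rest FS_rest GS_rest GS_sym interp ix])
qed

end
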